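(* Let $\mid\!\sim$ be a preferential inference relation on $\mathcal{L}$, and define the relation $\leq$ on $\mathcal{L}$ by: $\alpha\leq\beta$ iff $\neg\alpha\lor\neg\beta\mid\!\sim\neg\alpha$. Then $\leq$ is a weakly disjunctive partial entrenchment, and for all $\alpha,\beta\in\mathcal{L}$, $\alpha\mid\!\sim\beta$ if and only if $\alpha\mid\!\sim_\leq\beta$.
   Context: $\mathcal{L}$ is a propositional language closed under $\neg,\lor,\land,\to$; $\vdash$ classical consequence, $\mathrm{Cn}$ classical closure. A preferential inference relation is a relation $\mid\!\sim\subseteq\mathcal{L}\times\mathcal{L}$ satisfying system $\mathbf{P}$: Supraclassicality ($\alpha\vdash\beta\Rightarrow\alpha\mid\!\sim\beta$); Left Logical Equivalence (classically equivalent antecedents may be interchanged); Right Weakening ($\alpha\mid\!\sim\beta$, $\beta\vdash\gamma\Rightarrow\alpha\mid\!\sim\gamma$); And; Cut ($\alpha\mid\!\sim\beta$, $\alpha\land\beta\mid\!\sim\gamma\Rightarrow\alpha\mid\!\sim\gamma$); Cautious Monotonicity ($\alpha\mid\!\sim\beta$, $\alpha\mid\!\sim\gamma\Rightarrow\alpha\land\beta\mid\!\sim\gamma$); Or ($\alpha\mid\!\sim\gamma$, $\beta\mid\!\sim\gamma\Rightarrow\alpha\lor\beta\mid\!\sim\gamma$); Weak Transitivity ($\alpha\lor\beta\mid\!\sim\alpha$, $\beta\lor\gamma\mid\!\sim\beta\Rightarrow\alpha\lor\gamma\mid\!\sim\alpha$). A partial entrenchment is a binary relation $\leq$ on $\mathcal{L}$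 satisfying Transitivity, Dominance ($\alpha\vdash\beta\Rightarrow\alpha\leq\beta$) and Conjunction ($\gamma\leq\alpha,\gamma\leq\beta\Rightarrow\gamma\leq\alpha\land\beta$); it is weakly disjunctive if $\alpha\to\beta\leq\neg\alpha$ and $\alpha\to\gamma\leq\neg\alpha$ imply $\alpha\to(\beta\lor\gamma)\leq\neg\alpha$. A filter is a proper subset of $\mathcal{L}$ upper-closed under $\leq$ and closed under conjunction; $\mathcal{F}(\alpha)$ is the set of filters $F$ with $\beta\not\leq\neg\alpha$ for all $\beta\in F$; $\mathcal{F}_{\max}(\alpha)$ its $\subseteq$-maximal elements. Maxiconsistent inference: $\alpha\mid\!\sim_\leq\beta$ iff $\beta\in\mathrm{Cn}(F\cup\{\alpha\})$ for every $F\in\mathcal{F}_{\max}(\alpha)$.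
   Formalization: Filters are required to be non-empty; if the empty set counted as a filter, the equivalence would fail for a classically consistent α with α |~ ⊥ (for example when |~ is the total relation). *)

theory Defs
  imports Main
begin

datatype 'a form =
    Atom 'a
  | Neg "'a form"
  | Disj "'a form" "'a form" (infixr \<open>\<^bold>\<or>\<close> 68)
  | Conj "'a form" "'a form" (infixr \<open>\<^bold>\<and>\<close> 69)
  | Imp "'a form" "'a form" (infixr \<open>\<^bold>\<rightarrow>\<close> 67)

notation Neg (\<open>\<^bold>\<not> _\<close> [70] 70)

primrec holds :: "('a \<Rightarrow> bool) \<Rightarrow> 'a form \<Rightarrow> bool" where
  "holds v (Atom p) \<longleftrightarrow> v p"
| "holds v (\<^bold>\<not> \<alpha>) \<longleftrightarrow> \<not> holds v \<alpha>"
| "holds v (\<alpha> \<^bold>\<or> \<beta>) \<longleftrightarrow> holds v \<alpha> \<or> holds v \<beta>"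
| "holds v (\<alpha> \<^bold>\<and> \<beta>) \<longleftrightarrow> holds v \<alpha> \<and> holds v \<beta>"
| "holds v (\<alpha> \<^bold>\<rightarrow> \<beta>) \<longleftrightarrow> (holds v \<alpha> \<longrightarrow> holds v \<beta>)"

definition Cn :: "'a form set \<Rightarrow> 'a form set" where
  "Cn A = {\<beta>. \<forall>v. (\<forall>\<alpha>\<in>A. holds v \<alpha>) \<longrightarrow> holds v \<beta>}"

definition entails :: "'a form \<Rightarrow> 'a form \<Rightarrow> bool" (infix \<open>\<turnstile>\<close> 50) where
  "\<alpha> \<turnstile> \<beta> \<longleftrightarrow> \<beta> \<in> Cn {\<alpha>}"

locale preferential =
  fixes infer :: "'a form \<Rightarrow> 'a form \<Rightarrow> bool" (infix \<open>|~\<close> 50)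
  assumes supraclassicality: "\<alpha> \<turnstile> \<beta> \<Longrightarrow> \<alpha> |~ \<beta>"
    and left_logical_equivalence: "\<alpha> \<turnstile> \<beta> \<Longrightarrow> \<beta> \<turnstile> \<alpha> \<Longrightarrow> \<alpha> |~ \<gamma> \<Longrightarrow> \<beta> |~ \<gamma>"
    and right_weakening: "\<alpha> |~ \<beta> \<Longrightarrow> \<beta> \<turnstile> \<gamma> \<Longrightarrow> \<alpha> |~ \<gamma>"
    and and_rule: "\<alpha> |~ \<beta> \<Longrightarrow> \<alpha> |~ \<gamma> \<Longrightarrow> \<alpha> |~ \<beta> \<^bold>\<and> \<gamma>"
    and cut: "\<alpha> |~ \<beta> \<Longrightarrow> \<alpha> \<^bold>\<and> \<beta> |~ \<gamma> \<Longrightarrow> \<alpha> |~ \<gamma>"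
    and cautious_monotonicity: "\<alpha> |~ \<beta> \<Longrightarrow> \<alpha> |~ \<gamma> \<Longrightarrow> \<alpha> \<^bold>\<and> \<beta> |~ \<gamma>"
    and or_rule: "\<alpha> |~ \<gamma> \<Longrightarrow> \<beta> |~ \<gamma> \<Longrightarrow> \<alpha> \<^bold>\<or> \<beta> |~ \<gamma>"
    and weak_transitivity: "\<alpha> \<^bold>\<or> \<beta> |~ \<alpha> \<Longrightarrow> \<beta> \<^bold>\<or> \<gamma> |~ \<beta> \<Longrightarrow> \<alpha> \<^bold>\<or> \<gamma> |~ \<alpha>"

locale partial_entrenchment =
  fixes le :: "'a form \<Rightarrow> 'a form \<Rightarrow> bool" (infix \<open>\<preceq>\<close> 50)
  assumes transitivity: "\<alpha> \<preceq> \<beta> \<Longrightarrow> \<beta> \<preceq> \<gamma> \<Longrightarrow> \<alpha> \<preceq> \<gamma>"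
    and dominance: "\<alpha> \<turnstile> \<beta> \<Longrightarrow> \<alpha> \<preceq> \<beta>"
    and conjunction: "\<gamma> \<preceq> \<alpha> \<Longrightarrow> \<gamma> \<preceq> \<beta> \<Longrightarrow> \<gamma> \<preceq> \<alpha> \<^bold>\<and> \<beta>"

definition weakly_disjunctive :: "('a form \<Rightarrow> 'a form \<Rightarrow> bool) \<Rightarrow> bool" where
  "weakly_disjunctive le \<longleftrightarrow>
     (\<forall>\<alpha> \<beta> \<gamma>. le (\<alpha> \<^bold>\<rightarrow> \<beta>) (\<^bold>\<not> \<alpha>) \<longrightarrow> le (\<alpha> \<^bold>\<rightarrow> \<gamma>) (\<^bold>\<not> \<alpha>) \<longrightarrow>
        le (\<alpha> \<^bold>\<rightarrow> (\<beta> \<^bold>\<or> \<gamma>)) (\<^bold>\<not> \<alpha>))"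

text \<open>Filters are nonempty, as usual. If the empty set counted as a filter, it would be the only
  maximal filter for a classically consistent \<open>\<alpha>\<close> with \<open>\<alpha> |~ \<bottom>\<close>, so that maxiconsistent
  inference would not recover \<open>\<alpha> |~ \<bottom>\<close>.\<close>

definition le_filter :: "('a form \<Rightarrow> 'a form \<Rightarrow> bool) \<Rightarrow> 'a form set \<Rightarrow> bool" where
  "le_filter le F \<longleftrightarrow> F \<noteq> {} \<and> F \<noteq> UNIV \<and>
     (\<forall>\<alpha> \<beta>. \<alpha> \<in> F \<longrightarrow> le \<alpha> \<beta> \<longrightarrow> \<beta> \<in> F) \<and>
     (\<forall>\<alpha> \<beta>. \<alpha> \<in> F \<longrightarrow> \<beta> \<in> F \<longrightarrow> \<alpha> \<^bold>\<and> \<beta> \<in> F)"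

definition filters_of :: "('a form \<Rightarrow> 'a form \<Rightarrow> bool) \<Rightarrow> 'a form \<Rightarrow> 'a form set set" where
  "filters_of le \<alpha> = {F. le_filter le F \<and> (\<forall>\<beta>\<in>F. \<not> le \<beta> (\<^bold>\<not> \<alpha>))}"

definition max_filters_of :: "('a form \<Rightarrow> 'a form \<Rightarrow> bool) \<Rightarrow> 'a form \<Rightarrow> 'a form set set" where
  "max_filters_of le \<alpha> =
     {F \<in> filters_of le \<alpha>. \<forall>G \<in> filters_of le \<alpha>. F \<subseteq> G \<longrightarrow> G = F}"

definition maxi_infer ::
  "('a form \<Rightarrow> 'a form \<Rightarrow> bool) \<Rightarrow> 'a form \<Rightarrow> 'a form \<Rightarrow> bool" where
  "maxi_infer le \<alpha> \<beta> \<longleftrightarrow> (\<forall>F \<in> max_filters_of le \<alpha>. \<beta> \<in> Cn (F \<union> {\<alpha>}))"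

definition induced_le ::
  "('a form \<Rightarrow> 'a form \<Rightarrow> bool) \<Rightarrow> 'a form \<Rightarrow> 'a form \<Rightarrow> bool" where
  "induced_le infer \<alpha> \<beta> \<longleftrightarrow> infer (\<^bold>\<not> \<alpha> \<^bold>\<or> \<^bold>\<not> \<beta>) (\<^bold>\<not> \<alpha>)"

end

theory Submission
  imports Defs
begin

text \<open>
  The conditional is recovered from the entrenchment because \<open>\<alpha> |~ \<beta>\<close> holds exactly when
  \<open>\<alpha> \<rightarrow> \<not> \<beta> \<le> \<not> \<alpha>\<close>. If this inequality fails, the principal filter of \<open>\<alpha> \<rightarrow> \<not> \<beta>\<close> lies in
  \<open>\<F>(\<alpha>)\<close> and extends by Zorn's lemma to a maximal one; by compactness the latter is consistent
  with \<open>\<alpha>\<close>, so together with \<open>\<alpha>\<close> it yields \<open>\<not> \<beta>\<close> and not \<open>\<beta>\<close>. If it holds, every maximal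
  \<open>F\<close> contains \<open>\<alpha> \<rightarrow> \<beta>\<close>: otherwise \<open>\<phi> \<and> (\<alpha> \<rightarrow> \<beta>) \<le> \<not> \<alpha>\<close> for some \<open>\<phi> \<in> F\<close>, which says
  \<open>\<not> \<phi> \<or> \<alpha> |~ \<not> \<phi> \<or> (\<alpha> \<and> \<not> \<beta>)\<close>; combined with \<open>\<not> \<phi> \<or> \<alpha> |~ \<not> \<phi> \<or> \<beta>\<close>, an instance of Or,
  this gives \<open>\<phi> \<le> \<not> \<alpha>\<close>, contradicting \<open>F \<in> \<F>(\<alpha>)\<close>.
\<close>

lemma entails_iff: "\<alpha> \<turnstile> \<beta> \<longleftrightarrow> (\<forall>v. holds v \<alpha> \<longrightarrow> holds v \<beta>)"
  by (simp add: entails_def Cn_def)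

section \<open>Compactness\<close>

definition finitely_satisfiable :: "'a form set \<Rightarrow> bool" where
  "finitely_satisfiable S \<longleftrightarrow> (\<forall>T. T \<subseteq> S \<longrightarrow> finite T \<longrightarrow> (\<exists>v. \<forall>\<phi>\<in>T. holds v \<phi>))"

text \<open>If both extensions failed, two finite unsatisfiable witnesses, stripped of
  \<open>\<phi>\<close> and its negation, would share a model; that model decides
  \<open>\<phi>\<close> and so satisfies one of the witnesses.\<close>

lemma finitely_satisfiable_insert_or_Neg:
  assumes "finitely_satisfiable S"
  shows "finitely_satisfiable (insert \<phi> S) \<or> finitely_satisfiable (insert (\<^bold>\<not> \<phi>) S)"
proof (rule ccontr)
  assume "\<not> ?thesis"
  then obtain T U
    where T: "T \<subseteq> insert \<phi> S" "finite T" "\<nexists>v. \<forall>\<psi>\<in>T. holds v \<psi>"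
      and U: "U \<subseteq> insert (\<^bold>\<not> \<phi>) S" "finite U" "\<nexists>v. \<forall>\<psi>\<in>U. holds v \<psi>"
    unfolding finitely_satisfiable_def by blast
  have "(T - {\<phi>}) \<union> (U - {\<^bold>\<not> \<phi>}) \<subseteq> S" "finite ((T - {\<phi>}) \<union> (U - {\<^bold>\<not> \<phi>}))"
    using T U by auto
  then obtain v where v: "\<forall>\<psi> \<in> (T - {\<phi>}) \<union> (U - {\<^bold>\<not> \<phi>}). holds v \<psi>"
    using assms unfolding finitely_satisfiable_def by blast
  show False
  proof (cases "holds v \<phi>")
    case True
    then have "\<forall>\<psi>\<in>T. holds v \<psi>" using v by blast
    then show False using T(3) by blast
  next
    case False
    then have "holds v (\<^bold>\<not> \<phi>)" by simp
    then have "holds v \<psi>" if "\<psi> \<in> U" for \<psi>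
      using v that by (cases "\<psi> = \<^bold>\<not> \<phi>") auto
    then show False using U(3) by blast
  qed
qed

lemma finitely_satisfiable_Union_chain:
  assumes "subset.chain {S. finitely_satisfiable S} \<C>" and "\<C> \<noteq> {}"
  shows "finitely_satisfiable (\<Union>\<C>)"
  unfolding finitely_satisfiable_def
proof (intro allI impI)
  fix T assume "T \<subseteq> \<Union>\<C>" "finite T"
  then obtain S where "S \<in> \<C>" "T \<subseteq> S"
    using finite_subset_Union_chain[OF _ _ assms(2,1)] by metis
  moreover have "finitely_satisfiable S"
    using assms(1) \<open>S \<in> \<C>\<close> by (auto simp: subset.chain_def)
  ultimately show "\<exists>v. \<forall>\<phi>\<in>T. holds v \<phi>"
    using \<open>finite T\<close> unfolding finitely_satisfiable_def by blast
qed

text \<open>Lindenbaum's lemma: one of the two extensions of a Zorn-maximal \<open>M\<close> is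
  again finitely satisfiable, hence equal to \<open>M\<close>.\<close>

lemma finitely_satisfiable_extends_complete:
  assumes "finitely_satisfiable S"
  obtains M where "S \<subseteq> M" "finitely_satisfiable M" "\<And>\<phi>. \<phi> \<in> M \<or> \<^bold>\<not> \<phi> \<in> M"
proof -
  let ?A = "{M. finitely_satisfiable M \<and> S \<subseteq> M}"
  have "\<exists>M\<in>?A. \<forall>X\<in>?A. M \<subseteq> X \<longrightarrow> X = M"
  proof (rule subset_Zorn_nonempty)
    show "?A \<noteq> {}" using assms by blast
    fix \<C> assume \<C>: "\<C> \<noteq> {}" "subset.chain ?A \<C>"
    then have "subset.chain {M. finitely_satisfiable M} \<C>"
      by (auto simp: subset.chain_def)
    moreover have "S \<subseteq> \<Union>\<C>" using \<C> unfolding subset.chain_def by blast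
    ultimately show "\<Union>\<C> \<in> ?A" using finitely_satisfiable_Union_chain \<C>(1) by blast
  qed
  then obtain M where "M \<in> ?A" and max_A: "\<forall>X\<in>?A. M \<subseteq> X \<longrightarrow> X = M" ..
  then have M: "finitely_satisfiable M" "S \<subseteq> M" by auto
  have max: "X = M" if "finitely_satisfiable X" "M \<subseteq> X" for X
    using that max_A M(2) by auto
  have "\<phi> \<in> M \<or> \<^bold>\<not> \<phi> \<in> M" for \<phi>
    using finitely_satisfiable_insert_or_Neg[OF M(1), of \<phi>]
      max[of "insert \<phi> M"] max[of "insert (\<^bold>\<not> \<phi>) M"] by blast
  with M show thesis using that by blast
qed

text \<open>Truth lemma: each induction step involves only finitely many formulas, and on those
  \<open>M\<close> agrees with some valuation.\<close>

lemma complete_satisfiable: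
  assumes fs: "finitely_satisfiable M" and complete: "\<And>\<phi>. \<phi> \<in> M \<or> \<^bold>\<not> \<phi> \<in> M"
  shows "holds (\<lambda>p. Atom p \<in> M) \<phi> \<longleftrightarrow> \<phi> \<in> M"
proof -
  have agree: "\<exists>v. \<forall>\<psi>\<in>T. holds v \<psi> \<longleftrightarrow> \<psi> \<in> M" if "finite T" for T
  proof -
    \<comment> \<open>Negating the members of \<open>T\<close> outside \<open>M\<close> encodes the
      membership pattern of \<open>T\<close> as a finite subset of \<open>M\<close>.\<close>
    have "(T \<inter> M) \<union> Neg ` (T - M) \<subseteq> M" "finite ((T \<inter> M) \<union> Neg ` (T - M))"
      using complete that by auto
    then obtain v where v: "\<forall>\<psi> \<in> (T \<inter> M) \<union> Neg ` (T - M). holds v \<psi>"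
      using fs unfolding finitely_satisfiable_def by blast
    have "holds v \<psi> \<longleftrightarrow> \<psi> \<in> M" if "\<psi> \<in> T" for \<psi>
    proof (cases "\<psi> \<in> M")
      case False
      then have "holds v (\<^bold>\<not> \<psi>)" using v that by blast
      then show ?thesis using False by simp
    qed (use v that in blast)
    then show ?thesis by blast
  qed
  show ?thesis
  proof (induction \<phi>)
    case (Neg \<phi>)
    then show ?case using agree[of "{\<phi>, \<^bold>\<not> \<phi>}"] by auto
  next
    case (Disj \<phi> \<psi>)
    then show ?case using agree[of "{\<phi>, \<psi>, \<phi> \<^bold>\<or> \<psi>}"] by auto
  next
    case (Conj \<phi> \<psi>)
    then show ?case using agree[of "{\<phi>, \<psi>, \<phi> \<^bold>\<and> \<psi>}"] by auto
  next
    case (Imp \<phi> \<psi>)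
    then show ?case using agree[of "{\<phi>, \<psi>, \<phi> \<^bold>\<rightarrow> \<psi>}"] by auto
  qed simp
qed

theorem compactness:
  assumes "finitely_satisfiable S"
  shows "\<exists>v. \<forall>\<phi>\<in>S. holds v \<phi>"
proof -
  obtain M where "S \<subseteq> M" "finitely_satisfiable M" "\<And>\<phi>. \<phi> \<in> M \<or> \<^bold>\<not> \<phi> \<in> M"
    using finitely_satisfiable_extends_complete[OF assms] by blast
  then show ?thesis using complete_satisfiable[of M] by blast
qed

section \<open>Filters of a partial entrenchment\<close>

context partial_entrenchment
begin

text \<open>The bound conjoins \<open>T\<close> onto an arbitrary element of the filter, which
  exists because filters are nonempty.\<close>

lemma finite_subset_filter_lower_bound:
  assumes F: "le_filter le F" and "finite T" "T \<subseteq> F"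
  shows "\<exists>\<phi>\<in>F. \<forall>v. holds v \<phi> \<longrightarrow> (\<forall>\<psi>\<in>T. holds v \<psi>)"
  using assms(2,3)
proof (induction T rule: finite_induct)
  case empty
  then show ?case using F by (auto simp: le_filter_def)
next
  case (insert \<psi> T)
  then obtain \<phi> where \<phi>: "\<phi> \<in> F" "\<forall>v. holds v \<phi> \<longrightarrow> (\<forall>\<psi>\<in>T. holds v \<psi>)" by auto
  moreover have "\<psi> \<^bold>\<and> \<phi> \<in> F" using F \<phi>(1) insert.prems by (auto simp: le_filter_def)
  ultimately show ?case by (intro bexI[of _ "\<psi> \<^bold>\<and> \<phi>"]) auto
qed

text \<open>A single \<open>\<phi>\<close> in \<open>F\<close> entails any given finite part of
  \<open>F\<close>, and by Dominance it is consistent with \<open>\<alpha>\<close>; compactness does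
  the rest.\<close>

lemma filters_of_consistent:
  assumes "F \<in> filters_of le \<alpha>"
  obtains v where "\<forall>\<phi>\<in>F. holds v \<phi>" "holds v \<alpha>"
proof -
  have F: "le_filter le F" and no: "\<And>\<phi>. \<phi> \<in> F \<Longrightarrow> \<not> \<phi> \<preceq> \<^bold>\<not> \<alpha>"
    using assms by (auto simp: filters_of_def)
  have "finitely_satisfiable (insert \<alpha> F)"
    unfolding finitely_satisfiable_def
  proof (intro allI impI)
    fix T assume "T \<subseteq> insert \<alpha> F" "finite T"
    then have "finite (T - {\<alpha>})" "T - {\<alpha>} \<subseteq> F" by auto
    then obtain \<phi> where \<phi>: "\<phi> \<in> F" "\<forall>v. holds v \<phi> \<longrightarrow> (\<forall>\<psi>\<in>T - {\<alpha>}. holds v \<psi>)"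
      using finite_subset_filter_lower_bound[OF F] by blast
    have "\<not> \<phi> \<turnstile> \<^bold>\<not> \<alpha>" using no \<phi>(1) dominance by blast
    then obtain v where "holds v \<phi>" "holds v \<alpha>" by (auto simp: entails_iff)
    then show "\<exists>v. \<forall>\<psi>\<in>T. holds v \<psi>" using \<phi>(2) by blast
  qed
  from compactness[OF this] show thesis using that by blast
qed

lemma principal_filter:
  assumes "\<not> \<phi> \<preceq> \<^bold>\<not> \<alpha>"
  shows "{\<delta>. \<phi> \<preceq> \<delta>} \<in> filters_of le \<alpha>"
proof -
  have "\<phi> \<preceq> \<phi>" by (simp add: dominance entails_iff)
  moreover have "\<not> \<delta> \<preceq> \<^bold>\<not> \<alpha>" if "\<phi> \<preceq> \<delta>" for \<delta>
    using that assms transitivity by blast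
  moreover have "{\<delta>. \<phi> \<preceq> \<delta>} \<noteq> UNIV" using assms by blast
  ultimately show ?thesis
    unfolding filters_of_def le_filter_def
    by (auto intro: transitivity conjunction)
qed

lemma filters_of_Union_chain:
  assumes "subset.chain (filters_of le \<alpha>) \<C>" and "\<C> \<noteq> {}"
  shows "\<Union>\<C> \<in> filters_of le \<alpha>"
proof -
  have mem: "F \<in> filters_of le \<alpha>" if "F \<in> \<C>" for F
    using assms(1) that by (auto simp: subset.chain_def)
  have no: "\<not> \<phi> \<preceq> \<^bold>\<not> \<alpha>" if "\<phi> \<in> \<Union>\<C>" for \<phi>
    using that mem by (auto simp: filters_of_def)
  \<comment> \<open>By reflexivity \<open>\<not> \<alpha>\<close> itself is excluded, which makes
    the union proper.\<close>
  have "\<^bold>\<not> \<alpha> \<preceq> \<^bold>\<not> \<alpha>" by (simp add: dominance entails_iff)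
  then have "\<Union>\<C> \<noteq> UNIV" using no by blast
  moreover have "\<Union>\<C> \<noteq> {}"
    using assms(2) mem unfolding filters_of_def le_filter_def by blast
  moreover have "\<psi> \<in> \<Union>\<C>" if "\<phi> \<in> \<Union>\<C>" "\<phi> \<preceq> \<psi>" for \<phi> \<psi>
    using that mem unfolding filters_of_def le_filter_def by blast
  moreover have "\<phi> \<^bold>\<and> \<psi> \<in> \<Union>\<C>" if un: "\<phi> \<in> \<Union>\<C>" "\<psi> \<in> \<Union>\<C>" for \<phi> \<psi>
  proof -
    obtain F G where FG: "F \<in> \<C>" "\<phi> \<in> F" "G \<in> \<C>" "\<psi> \<in> G" using un by blast
    then have "F \<subseteq> G \<or> G \<subseteq> F" using assms(1) by (auto simp: subset_chain_def)
    then obtain H where H: "H \<in> \<C>" "\<phi> \<in> H" "\<psi> \<in> H" using FG by blast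
    then have "\<phi> \<^bold>\<and> \<psi> \<in> H" using mem[OF H(1)] by (simp add: filters_of_def le_filter_def)
    then show ?thesis using H(1) by blast
  qed
  ultimately have "le_filter le (\<Union>\<C>)" unfolding le_filter_def by blast
  then show ?thesis using no by (auto simp: filters_of_def)
qed

lemma filters_of_extends_max:
  assumes "F \<in> filters_of le \<alpha>"
  obtains M where "M \<in> max_filters_of le \<alpha>" "F \<subseteq> M"
proof -
  let ?A = "{G \<in> filters_of le \<alpha>. F \<subseteq> G}"
  have "\<exists>M\<in>?A. \<forall>X\<in>?A. M \<subseteq> X \<longrightarrow> X = M"
  proof (rule subset_Zorn_nonempty)
    show "?A \<noteq> {}" using assms by blast
    fix \<C> assume \<C>: "\<C> \<noteq> {}" "subset.chain ?A \<C>"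
    then have "subset.chain (filters_of le \<alpha>) \<C>" by (auto simp: subset.chain_def)
    moreover have "F \<subseteq> \<Union>\<C>" using \<C> unfolding subset.chain_def by blast
    ultimately show "\<Union>\<C> \<in> ?A" using filters_of_Union_chain \<C>(1) by blast
  qed
  then obtain M where "M \<in> ?A" and max: "\<forall>X\<in>?A. M \<subseteq> X \<longrightarrow> X = M" ..
  then have "M \<in> max_filters_of le \<alpha>" "F \<subseteq> M" by (auto simp: max_filters_of_def)
  then show thesis by (rule that)
qed

text \<open>The hypothesis keeps \<open>\<not> \<alpha>\<close> out of the filter generated by
  \<open>M\<close> and \<open>\<chi>\<close>, so maximality forces that filter to be
  \<open>M\<close>.\<close>

lemma max_filters_of_memI:
  assumes M: "M \<in> max_filters_of le \<alpha>" and "\<And>\<phi>. \<phi> \<in> M \<Longrightarrow> \<not> \<phi> \<^bold>\<and> \<chi> \<preceq> \<^bold>\<not> \<alpha>"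
  shows "\<chi> \<in> M"
proof -
  \<comment> \<open>The filter generated by \<open>M\<close> and \<open>\<chi>\<close>.\<close>
  let ?G = "{\<delta>. \<exists>\<phi>\<in>M. \<phi> \<^bold>\<and> \<chi> \<preceq> \<delta>}"
  have F: "le_filter le M" using M by (auto simp: max_filters_of_def filters_of_def)
  have sub: "M \<subseteq> ?G" by (auto intro!: dominance simp: entails_iff)
  have \<chi>: "\<chi> \<in> ?G"
    using F by (auto simp: le_filter_def entails_iff intro!: dominance)
  have no: "\<not> \<delta> \<preceq> \<^bold>\<not> \<alpha>" if "\<delta> \<in> ?G" for \<delta>
    using that assms(2) transitivity by blast
  have "\<^bold>\<not> \<alpha> \<preceq> \<^bold>\<not> \<alpha>" by (simp add: dominance entails_iff)
  then have "?G \<noteq> UNIV" using no by blast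
  moreover have "?G \<noteq> {}" using \<chi> by blast
  moreover have "\<epsilon> \<in> ?G" if "\<delta> \<in> ?G" "\<delta> \<preceq> \<epsilon>" for \<delta> \<epsilon>
    using that transitivity by blast
  moreover have "\<delta> \<^bold>\<and> \<epsilon> \<in> ?G" if mem: "\<delta> \<in> ?G" "\<epsilon> \<in> ?G" for \<delta> \<epsilon>
  proof -
    obtain \<phi> \<psi> where \<phi>\<psi>: "\<phi> \<in> M" "\<phi> \<^bold>\<and> \<chi> \<preceq> \<delta>" "\<psi> \<in> M" "\<psi> \<^bold>\<and> \<chi> \<preceq> \<epsilon>"
      using mem by blast
    have "(\<phi> \<^bold>\<and> \<psi>) \<^bold>\<and> \<chi> \<preceq> \<phi> \<^bold>\<and> \<chi>" "(\<phi> \<^bold>\<and> \<psi>) \<^bold>\<and> \<chi> \<preceq> \<psi> \<^bold>\<and> \<chi>"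
      by (auto intro!: dominance simp: entails_iff)
    then have "(\<phi> \<^bold>\<and> \<psi>) \<^bold>\<and> \<chi> \<preceq> \<delta> \<^bold>\<and> \<epsilon>" using \<phi>\<psi> transitivity conjunction by blast
    moreover have "\<phi> \<^bold>\<and> \<psi> \<in> M" using F \<phi>\<psi> by (auto simp: le_filter_def)
    ultimately show ?thesis by blast
  qed
  ultimately have "le_filter le ?G" unfolding le_filter_def by blast
  then have "?G \<in> filters_of le \<alpha>" using no by (auto simp: filters_of_def)
  then have "?G = M" using M sub by (auto simp: max_filters_of_def)
  with \<chi> show ?thesis by blast
qed

end

section \<open>The entrenchment induced by a preferential inference relation\<close>

context preferential
begin

text \<open>Packages Left Logical Equivalence and Right Weakening as truth-table conditions.\<close>

lemma infer_cong:
  assumes "\<alpha> |~ \<beta>" and "\<And>v. holds v \<alpha> \<longleftrightarrow> holds v \<alpha>'" and "\<And>v. holds v \<beta> \<Longrightarrow> holds v \<beta>'"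
  shows "\<alpha>' |~ \<beta>'"
  using left_logical_equivalence[of \<alpha> \<alpha>' \<beta>] right_weakening[of \<alpha>' \<beta> \<beta>'] assms
  by (simp add: entails_iff)

text \<open>Transitivity is Weak Transitivity for the negations and Dominance is Supraclassicality
  by contraposition. Conjunction is Or, since
  \<open>\<not> \<gamma> \<or> \<not> (\<alpha> \<and> \<beta>)\<close> is the disjunction of the
  two antecedents.\<close>

lemma partial_entrenchment_induced_le: "partial_entrenchment (induced_le infer)"
proof
  fix \<alpha> \<beta> \<gamma> :: "'a form"
  show "induced_le infer \<alpha> \<gamma>" if "induced_le infer \<alpha> \<beta>" "induced_le infer \<beta> \<gamma>"
    using that weak_transitivity unfolding induced_le_def by blast
  show "induced_le infer \<alpha> \<beta>" if "\<alpha> \<turnstile> \<beta>"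
    using that by (auto simp: induced_le_def entails_iff intro!: supraclassicality)
  show "induced_le infer \<gamma> (\<alpha> \<^bold>\<and> \<beta>)" if "induced_le infer \<gamma> \<alpha>" "induced_le infer \<gamma> \<beta>"
    unfolding induced_le_def
    by (rule infer_cong[OF or_rule[OF that[unfolded induced_le_def]]]) auto
qed

text \<open>Unfolded, the antecedent is equivalent to \<open>\<alpha>\<close> and the consequent to
  \<open>\<alpha> \<and> \<not> \<beta>\<close>.\<close>

lemma induced_le_Imp_Neg: "induced_le infer (\<alpha> \<^bold>\<rightarrow> \<beta>) (\<^bold>\<not> \<alpha>) \<longleftrightarrow> \<alpha> |~ \<^bold>\<not> \<beta>"
proof
  assume "induced_le infer (\<alpha> \<^bold>\<rightarrow> \<beta>) (\<^bold>\<not> \<alpha>)"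
  then show "\<alpha> |~ \<^bold>\<not> \<beta>" unfolding induced_le_def by (rule infer_cong) auto
next
  assume "\<alpha> |~ \<^bold>\<not> \<beta>"
  moreover have "\<alpha> |~ \<alpha>" by (simp add: supraclassicality entails_iff)
  ultimately have "\<alpha> |~ \<alpha> \<^bold>\<and> \<^bold>\<not> \<beta>" using and_rule by blast
  then show "induced_le infer (\<alpha> \<^bold>\<rightarrow> \<beta>) (\<^bold>\<not> \<alpha>)"
    unfolding induced_le_def by (rule infer_cong) auto
qed

text \<open>Translated back to inference, this is And followed by De Morgan.\<close>

lemma weakly_disjunctive_induced_le: "weakly_disjunctive (induced_le infer)"
  unfolding weakly_disjunctive_def induced_le_Imp_Neg
proof (intro allI impI)
  fix \<alpha> \<beta> \<gamma> assume "\<alpha> |~ \<^bold>\<not> \<beta>" "\<alpha> |~ \<^bold>\<not> \<gamma>"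
  from and_rule[OF this] show "\<alpha> |~ \<^bold>\<not> (\<beta> \<^bold>\<or> \<gamma>)" by (rule infer_cong) auto
qed

text \<open>Its contrapositive supplies the premise of \<open>max_filters_of_memI\<close> for
  \<open>\<alpha> \<rightarrow> \<beta>\<close>.\<close>

lemma induced_le_Neg_if_Conj_Imp:
  assumes "\<alpha> |~ \<beta>" and "induced_le infer (\<phi> \<^bold>\<and> (\<alpha> \<^bold>\<rightarrow> \<beta>)) (\<^bold>\<not> \<alpha>)"
  shows "induced_le infer \<phi> (\<^bold>\<not> \<alpha>)"
proof -
  let ?\<delta> = "\<^bold>\<not> \<phi> \<^bold>\<or> \<^bold>\<not> \<^bold>\<not> \<alpha>"
  have "\<^bold>\<not> \<phi> |~ \<^bold>\<not> \<phi> \<^bold>\<or> \<beta>" by (simp add: supraclassicality entails_iff)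
  moreover have "\<^bold>\<not> \<^bold>\<not> \<alpha> |~ \<^bold>\<not> \<phi> \<^bold>\<or> \<beta>" by (rule infer_cong[OF assms(1)]) auto
  ultimately have "?\<delta> |~ \<^bold>\<not> \<phi> \<^bold>\<or> \<beta>" by (rule or_rule)
  moreover have "?\<delta> |~ \<^bold>\<not> \<phi> \<^bold>\<or> (\<alpha> \<^bold>\<and> \<^bold>\<not> \<beta>)"
    by (rule infer_cong[OF assms(2)[unfolded induced_le_def]]) auto
  ultimately have "?\<delta> |~ (\<^bold>\<not> \<phi> \<^bold>\<or> \<beta>) \<^bold>\<and> (\<^bold>\<not> \<phi> \<^bold>\<or> (\<alpha> \<^bold>\<and> \<^bold>\<not> \<beta>))"
    by (rule and_rule)
  \<comment> \<open>The two right disjuncts contradict each other, so only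
    \<open>\<not> \<phi>\<close> remains.\<close>
  then show ?thesis unfolding induced_le_def by (rule infer_cong) auto
qed

lemma infer_iff_maxi_infer: "\<alpha> |~ \<beta> \<longleftrightarrow> maxi_infer (induced_le infer) \<alpha> \<beta>"
proof
  interpret le: partial_entrenchment "induced_le infer"
    by (rule partial_entrenchment_induced_le)
  assume "\<alpha> |~ \<beta>"
  show "maxi_infer (induced_le infer) \<alpha> \<beta>"
    unfolding maxi_infer_def
  proof
    fix F assume F: "F \<in> max_filters_of (induced_le infer) \<alpha>"
    then have "\<And>\<phi>. \<phi> \<in> F \<Longrightarrow> \<not> induced_le infer \<phi> (\<^bold>\<not> \<alpha>)"
      by (auto simp: max_filters_of_def filters_of_def)
    then have "\<alpha> \<^bold>\<rightarrow> \<beta> \<in> F"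
      using le.max_filters_of_memI[OF F] induced_le_Neg_if_Conj_Imp[OF \<open>\<alpha> |~ \<beta>\<close>] by blast
    then show "\<beta> \<in> Cn (F \<union> {\<alpha>})" by (force simp: Cn_def)
  qed
next
  interpret le: partial_entrenchment "induced_le infer"
    by (rule partial_entrenchment_induced_le)
  assume maxi: "maxi_infer (induced_le infer) \<alpha> \<beta>"
  show "\<alpha> |~ \<beta>"
  proof (rule ccontr)
    assume "\<not> \<alpha> |~ \<beta>"
    \<comment> \<open>The double negation matches the negated consequent in
      \<open>induced_le_Imp_Neg\<close>.\<close>
    then have "\<not> \<alpha> |~ \<^bold>\<not> \<^bold>\<not> \<beta>" using infer_cong[of \<alpha> "\<^bold>\<not> \<^bold>\<not> \<beta>" \<alpha> \<beta>] by auto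
    then have "\<not> induced_le infer (\<alpha> \<^bold>\<rightarrow> \<^bold>\<not> \<beta>) (\<^bold>\<not> \<alpha>)" by (simp add: induced_le_Imp_Neg)
    from le.principal_filter[OF this] obtain M
      where M: "M \<in> max_filters_of (induced_le infer) \<alpha>"
        and sub: "{\<delta>. induced_le infer (\<alpha> \<^bold>\<rightarrow> \<^bold>\<not> \<beta>) \<delta>} \<subseteq> M"
      by (rule le.filters_of_extends_max)
    \<comment> \<open>The generator lies in its own principal filter by reflexivity.\<close>
    have mem: "\<alpha> \<^bold>\<rightarrow> \<^bold>\<not> \<beta> \<in> M" using sub by (auto simp: le.dominance entails_iff)
    from M have "M \<in> filters_of (induced_le infer) \<alpha>" by (simp add: max_filters_of_def)
    then obtain v where v: "\<forall>\<phi>\<in>M. holds v \<phi>" "holds v \<alpha>"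
      by (rule le.filters_of_consistent)
    moreover have "\<beta> \<in> Cn (M \<union> {\<alpha>})" using maxi M by (simp add: maxi_infer_def)
    ultimately have "holds v \<beta>" by (auto simp: Cn_def)
    moreover have "holds v (\<alpha> \<^bold>\<rightarrow> \<^bold>\<not> \<beta>)" using mem v(1) by blast
    ultimately show False using v(2) by simp
  qed
qed

end

theorem theorem2:
  fixes infer :: "'a form \<Rightarrow> 'a form \<Rightarrow> bool"
  assumes "preferential infer"
  shows "partial_entrenchment (induced_le infer) \<and>
         weakly_disjunctive (induced_le infer) \<and>
         (\<forall>\<alpha> \<beta>. infer \<alpha> \<beta> \<longleftrightarrow> maxi_infer (induced_le infer) \<alpha> \<beta>)"
  using preferential.partial_entrenchment_induced_le[OF assms]
    preferential.weakly_disjunctive_induced_le[OF assms]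
    preferential.infer_iff_maxi_infer[OF assms] by simp

end
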